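(* Let $(\Omega,\mathcal{A},p)$ be a probability space with a filtration $\mathcal{F}=(\mathcal{F}_n)_{n\ge0}$. For every finite set $C$, every $C$-valued $\mathcal{F}$-consistent NT function $c$ and every $\varepsilon>0$, there exists a sequence of bounded stopping times $0\le\theta_0<\theta_1<\theta_2<\cdots$ (with respect to $\mathcal{F}$) such that $$p\big(c_{\theta_0,\theta_1}=c_{\theta_1,\theta_2}=c_{\theta_2,\theta_3}=\cdots\big)>1-\varepsilon .$$
   Context: For $A,B\in\mathcal{A}$, "$A$ holds on $B$" means $p(A^c\cap B)=0$. An NT function is a function $f$ that assigns to every integer $n\ge0$ and every bounded stopping time $\tau$ of $\mathcal{F}$ an $\mathcal{F}_n$-measurable random variable $f_{n,\tau}$ defined over the set $\{\tau>n\}$. It is $C$-valued if every $f_{n,\tau}$ takes values in $C$. An NT function $f$ is $\mathcal{F}$-consistent if for every $n\ge0$, every $F\in\mathcal{F}_n$ and every two bounded stopping times $\tau_1,\tau_2$: if $\tau_1=\tau_2>n$ on $F$, then $f_{n,\tau_1}=f_{n,\tau_2}$ on $F$. For bounded stopping times $\sigma<\tau$, $f_{\sigma,\tau}(\omega)=f_{\sigma(\omega),\tau}(\omega)$. *)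

theory Defs
  imports "HOL-Probability.Probability"
begin

definition bounded_stopping_time :: "'a measure \<Rightarrow> (nat \<Rightarrow> 'a measure) \<Rightarrow> ('a \<Rightarrow> nat) \<Rightarrow> bool"
  where "bounded_stopping_time M F \<tau> \<longleftrightarrow>
    stopping_time F \<tau> \<and> (\<exists>N. \<forall>\<omega>\<in>space M. \<tau> \<omega> \<le> N)"

(* "P holds on B" for a property P of points. The AE form needs no measurability of P off B, where
   P may involve values of partially defined random variables; for events it is the condition
   p(A^c \<inter> B) = 0, see holds_on_event_iff. *)
definition holds_on :: "'a measure \<Rightarrow> ('a \<Rightarrow> bool) \<Rightarrow> 'a set \<Rightarrow> bool"
  where "holds_on M P B \<longleftrightarrow> (AE \<omega> in M. \<omega> \<in> B \<longrightarrow> P \<omega>)"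

lemma (in prob_space) holds_on_event_iff:
  assumes "A \<in> events" "B \<in> events"
  shows "holds_on M (\<lambda>\<omega>. \<omega> \<in> A) B \<longleftrightarrow> prob ((space M - A) \<inter> B) = 0"
proof -
  have "{\<omega> \<in> space M. \<not> (\<omega> \<in> B \<longrightarrow> \<omega> \<in> A)} = (space M - A) \<inter> B"
    by auto
  then show ?thesis
    using assms unfolding holds_on_def
    by (subst AE_iff_measurable) (auto simp: emeasure_eq_measure)
qed

(* S is the space of values. The random variable f n \<tau> is defined over {\<tau> > n} only; as HOL
   functions are total, its values elsewhere are arbitrary and must never be used. *)
definition NT_function ::
  "'a measure \<Rightarrow> (nat \<Rightarrow> 'a measure) \<Rightarrow> 'c measure \<Rightarrow> (nat \<Rightarrow> ('a \<Rightarrow> nat) \<Rightarrow> 'a \<Rightarrow> 'c) \<Rightarrow> bool"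
  where "NT_function M F S f \<longleftrightarrow>
    (\<forall>n \<tau>. bounded_stopping_time M F \<tau> \<longrightarrow>
      f n \<tau> \<in> restrict_space (F n) {\<omega> \<in> space M. n < \<tau> \<omega>} \<rightarrow>\<^sub>M S)"

definition valued_in ::
  "'a measure \<Rightarrow> (nat \<Rightarrow> 'a measure) \<Rightarrow> 'c set \<Rightarrow> (nat \<Rightarrow> ('a \<Rightarrow> nat) \<Rightarrow> 'a \<Rightarrow> 'c) \<Rightarrow> bool"
  where "valued_in M F C f \<longleftrightarrow>
    (\<forall>n \<tau>. bounded_stopping_time M F \<tau> \<longrightarrow>
      (\<forall>\<omega>\<in>space M. n < \<tau> \<omega> \<longrightarrow> f n \<tau> \<omega> \<in> C))"

definition consistent ::
  "'a measure \<Rightarrow> (nat \<Rightarrow> 'a measure) \<Rightarrow> (nat \<Rightarrow> ('a \<Rightarrow> nat) \<Rightarrow> 'a \<Rightarrow> 'c) \<Rightarrow> bool"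
  where "consistent M F f \<longleftrightarrow>
    (\<forall>n. \<forall>A\<in>sets (F n). \<forall>\<tau>\<^sub>1 \<tau>\<^sub>2.
      bounded_stopping_time M F \<tau>\<^sub>1 \<longrightarrow> bounded_stopping_time M F \<tau>\<^sub>2 \<longrightarrow>
      holds_on M (\<lambda>\<omega>. \<tau>\<^sub>1 \<omega> = \<tau>\<^sub>2 \<omega> \<and> n < \<tau>\<^sub>2 \<omega>) A \<longrightarrow>
      holds_on M (\<lambda>\<omega>. f n \<tau>\<^sub>1 \<omega> = f n \<tau>\<^sub>2 \<omega>) A)"

definition NT_at ::
  "(nat \<Rightarrow> ('a \<Rightarrow> nat) \<Rightarrow> 'a \<Rightarrow> 'c) \<Rightarrow> ('a \<Rightarrow> nat) \<Rightarrow> ('a \<Rightarrow> nat) \<Rightarrow> 'a \<Rightarrow> 'c"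
  where "NT_at f \<sigma> \<tau> \<omega> = f (\<sigma> \<omega>) \<tau> \<omega>"

end

theory Submission
  imports Defs
begin

text \<open>
  Induction on the number of colours. Fix a colour \<open>r\<close>. For each \<open>n\<close> let \<open>R\<^sub>n \<in> \<F>\<^sub>n\<close> be the essential
  union of the events \<open>c\<^sub>n\<^sub>,\<^sub>\<tau> = r\<close> over all bounded \<open>\<tau> > n\<close>. Consistency allows one to paste stopping
  times along \<open>\<F>\<^sub>n\<close>-events, so \<open>R\<^sub>n\<close> is approximated by a single such event, whereas off \<open>R\<^sub>n\<close>
  no stopping time produces the colour \<open>r\<close>. Up to a small probability, an event \<open>A \<in> \<F>\<^sub>m\<close> decides
  whether the complements of the \<open>R\<^sub>n\<close> occur infinitely often. Off \<open>A\<close> only the \<open>R\<^sub>n\<close> occur from some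
  time on, and one moves greedily from \<open>n\<close> to a \<open>\<tau>\<close> with \<open>c\<^sub>n\<^sub>,\<^sub>\<tau> = r\<close>. On \<open>A\<close> one samples the filtration at
  successive visits to the complements; the sampled colouring avoids \<open>r\<close> there, and the
  induction hypothesis applies to it.
\<close>

section \<open>Bounded stopping times\<close>

locale filtered_prob_space = prob_space M + filtration "space M" F
  for M :: "'a measure" and F :: "nat \<Rightarrow> 'a measure" +
  assumes subalg: "\<And>n. subalgebra M (F n)"
begin

abbreviation "bstime \<equiv> bounded_stopping_time M F"

lemma sets_F_events: "A \<in> sets (F n) \<Longrightarrow> A \<in> events"
  using subalg by (auto simp: subalgebra_def)

lemma sets_F_le: "A \<in> sets (F m) \<Longrightarrow> m \<le> n \<Longrightarrow> A \<in> sets (F n)"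
  using sets_F_mono by blast

lemma sets_F_Compl: "A \<in> sets (F n) \<Longrightarrow> space M - A \<in> sets (F n)"
  using space_F by (metis sets.compl_sets)

text \<open>Time is discrete, so the event of stopping by time t is a finite union of level sets.
  Level sets suit pasted times best, because each one splits along the pasting rule.\<close>

lemma stopping_time_iff_eq:
  "stopping_time F \<tau> \<longleftrightarrow> (\<forall>t. {\<omega> \<in> space M. \<tau> \<omega> = t} \<in> sets (F t))"
proof
  assume "stopping_time F \<tau>"
  then show "\<forall>t. {\<omega> \<in> space M. \<tau> \<omega> = t} \<in> sets (F t)"
    using stopping_time_eq_const by (auto simp: pred_def space_F)
next
  assume eq: "\<forall>t. {\<omega> \<in> space M. \<tau> \<omega> = t} \<in> sets (F t)"
  show "stopping_time F \<tau>"
  proof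
    fix t
    have "(\<Union>s\<le>t. {\<omega> \<in> space M. \<tau> \<omega> = s}) \<in> sets (F t)"
      using eq by (intro sets.countable_UN') (auto intro: sets_F_le)
    also have "(\<Union>s\<le>t. {\<omega> \<in> space M. \<tau> \<omega> = s}) = {\<omega> \<in> space (F t). \<tau> \<omega> \<le> t}"
      by (auto simp: space_F)
    finally show "Measurable.pred (F t) (\<lambda>\<omega>. \<tau> \<omega> \<le> t)"
      by (simp add: pred_def)
  qed
qed

text \<open>The same passage to level sets. It lifts statements about each fixed \<open>F t\<close>
  to the random time \<rho> by cutting an event along the values of \<rho>.\<close>

lemma sets_pre_sigma_iff_eq:
  assumes "stopping_time F \<rho>"
  shows "A \<in> sets (pre_sigma \<rho>) \<longleftrightarrow> A \<subseteq> space M \<and> (\<forall>t. {\<omega> \<in> A. \<rho> \<omega> = t} \<in> sets (F t))"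
proof (intro iffI conjI allI)
  assume A: "A \<in> sets (pre_sigma \<rho>)"
  show sub: "A \<subseteq> space M"
    using sets.sets_into_space[OF A] by (simp add: space_pre_sigma)
  fix t
  have "{\<omega> \<in> A. \<rho> \<omega> \<le> t} \<inter> {\<omega> \<in> space M. \<rho> \<omega> = t} \<in> sets (F t)"
    using sets_pre_sigmaD[OF assms A] assms stopping_time_iff_eq by auto
  also have "{\<omega> \<in> A. \<rho> \<omega> \<le> t} \<inter> {\<omega> \<in> space M. \<rho> \<omega> = t} = {\<omega> \<in> A. \<rho> \<omega> = t}"
    using sub by auto
  finally show "{\<omega> \<in> A. \<rho> \<omega> = t} \<in> sets (F t)" .
next
  assume A: "A \<subseteq> space M \<and> (\<forall>t. {\<omega> \<in> A. \<rho> \<omega> = t} \<in> sets (F t))"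
  show "A \<in> sets (pre_sigma \<rho>)"
  proof (rule sets_pre_sigmaI[OF assms])
    fix t
    have "(\<Union>s\<le>t. {\<omega> \<in> A. \<rho> \<omega> = s}) \<in> sets (F t)"
      using A by (intro sets.countable_UN') (auto intro: sets_F_le)
    also have "(\<Union>s\<le>t. {\<omega> \<in> A. \<rho> \<omega> = s}) = {\<omega> \<in> A. \<rho> \<omega> \<le> t}" by auto
    finally show "{\<omega> \<in> A. \<rho> \<omega> \<le> t} \<in> sets (F t)" .
  qed
qed

lemma bstime_stopping_time: "bstime \<tau> \<Longrightarrow> stopping_time F \<tau>"
  by (simp add: bounded_stopping_time_def)

lemma bstime_eq_sets: "bstime \<tau> \<Longrightarrow> {\<omega> \<in> space M. \<tau> \<omega> = t} \<in> sets (F t)"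
  using bstime_stopping_time stopping_time_iff_eq by blast

lemma bstime_gt_sets: "bstime \<tau> \<Longrightarrow> {\<omega> \<in> space M. n < \<tau> \<omega>} \<in> sets (F n)"
  using stopping_timeD2[OF bstime_stopping_time] by (simp add: pred_def space_F)

lemma bstimeE:
  assumes "bstime \<tau>"
  obtains N where "\<And>\<omega>. \<omega> \<in> space M \<Longrightarrow> \<tau> \<omega> \<le> N"
  using assms by (auto simp: bounded_stopping_time_def)

lemma bstimeI:
  assumes "\<And>t. {\<omega> \<in> space M. \<tau> \<omega> = t} \<in> sets (F t)" "\<And>\<omega>. \<omega> \<in> space M \<Longrightarrow> \<tau> \<omega> \<le> N"
  shows "bstime \<tau>"
  using assms stopping_time_iff_eq by (auto simp: bounded_stopping_time_def)

lemma bstime_const: "bstime (\<lambda>_. k)"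
  by (auto simp: bounded_stopping_time_def stopping_time_const)

lemma bstime_max: "bstime \<tau>\<^sub>1 \<Longrightarrow> bstime \<tau>\<^sub>2 \<Longrightarrow> bstime (\<lambda>\<omega>. max (\<tau>\<^sub>1 \<omega>) (\<tau>\<^sub>2 \<omega>))"
  unfolding bounded_stopping_time_def
  by (intro conjI stopping_time_max) (auto, meson max.bounded_iff max.cobounded1 max.cobounded2 order_trans)

text \<open>At time n it is known which branch applies, and neither branch stops before n. So levels
  from n on split into two known pieces, and levels below n are empty.\<close>

lemma bstime_if:
  assumes "A \<in> sets (F n)" "bstime \<tau>\<^sub>1" "bstime \<tau>\<^sub>2"
    and "\<And>\<omega>. \<omega> \<in> A \<Longrightarrow> n \<le> \<tau>\<^sub>1 \<omega>" "\<And>\<omega>. \<omega> \<in> space M - A \<Longrightarrow> n \<le> \<tau>\<^sub>2 \<omega>"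
  shows "bstime (\<lambda>\<omega>. if \<omega> \<in> A then \<tau>\<^sub>1 \<omega> else \<tau>\<^sub>2 \<omega>)"
proof -
  obtain N1 N2 where N: "\<And>\<omega>. \<omega> \<in> space M \<Longrightarrow> \<tau>\<^sub>1 \<omega> \<le> N1" "\<And>\<omega>. \<omega> \<in> space M \<Longrightarrow> \<tau>\<^sub>2 \<omega> \<le> N2"
    using bstimeE[OF assms(2)] bstimeE[OF assms(3)] by metis
  show ?thesis
  proof (rule bstimeI[where N = "max N1 N2"])
    fix t
    have sub: "A \<subseteq> space M"
      using sets.sets_into_space[OF assms(1)] by (simp add: space_F)
    show "{\<omega> \<in> space M. (if \<omega> \<in> A then \<tau>\<^sub>1 \<omega> else \<tau>\<^sub>2 \<omega>) = t} \<in> sets (F t)"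
    proof (cases "n \<le> t")
      case True
      have "A \<inter> {\<omega> \<in> space M. \<tau>\<^sub>1 \<omega> = t} \<union> (space M - A) \<inter> {\<omega> \<in> space M. \<tau>\<^sub>2 \<omega> = t} \<in> sets (F t)"
        using sets_F_le[OF assms(1) True] by (intro sets.Un sets.Int sets_F_Compl bstime_eq_sets assms) auto
      also have "A \<inter> {\<omega> \<in> space M. \<tau>\<^sub>1 \<omega> = t} \<union> (space M - A) \<inter> {\<omega> \<in> space M. \<tau>\<^sub>2 \<omega> = t}
        = {\<omega> \<in> space M. (if \<omega> \<in> A then \<tau>\<^sub>1 \<omega> else \<tau>\<^sub>2 \<omega>) = t}"
        using sub by auto
      finally show ?thesis .
    next
      case False
      then have "{\<omega> \<in> space M. (if \<omega> \<in> A then \<tau>\<^sub>1 \<omega> else \<tau>\<^sub>2 \<omega>) = t} = {}"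
        using assms(4,5) by (force split: if_splits)
      then show ?thesis by (simp only: sets.empty_sets)
    qed
  qed (auto simp: N le_max_iff_disj)
qed

text \<open>This is a restart: having stopped at m, follow \<open>T m\<close>. Since the new time is
  never earlier than \<rho>, only values m \<le> t contribute to level t.\<close>

lemma bstime_select:
  assumes \<rho>: "bstime \<rho>" and T: "\<And>m. bstime (T m)" and ge: "\<And>\<omega>. \<omega> \<in> space M \<Longrightarrow> \<rho> \<omega> \<le> T (\<rho> \<omega>) \<omega>"
  shows "bstime (\<lambda>\<omega>. T (\<rho> \<omega>) \<omega>)"
proof -
  obtain N where N: "\<And>\<omega>. \<omega> \<in> space M \<Longrightarrow> \<rho> \<omega> \<le> N"
    using bstimeE[OF \<rho>] by metis
  have bounded_T: "\<exists>K. \<forall>\<omega>\<in>space M. T m \<omega> \<le> K" for m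
    using T by (auto simp: bounded_stopping_time_def)
  obtain K where K: "\<And>m \<omega>. \<omega> \<in> space M \<Longrightarrow> T m \<omega> \<le> K m"
    using bounded_T by metis
  \<comment> \<open>The bounds \<open>K m\<close> depend on m; a common one exists because \<rho>
    takes only values up to \<open>N\<close>.\<close>
  show ?thesis
  proof (rule bstimeI[where N = "Max (K ` {..N})"])
    fix t
    have "(\<Union>m\<le>t. {\<omega> \<in> space M. \<rho> \<omega> = m} \<inter> {\<omega> \<in> space M. T m \<omega> = t}) \<in> sets (F t)"
      using sets_F_le[OF bstime_eq_sets[OF \<rho>]] bstime_eq_sets[OF T]
      by (intro sets.countable_UN' sets.Int) auto
    also have "(\<Union>m\<le>t. {\<omega> \<in> space M. \<rho> \<omega> = m} \<inter> {\<omega> \<in> space M. T m \<omega> = t})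
      = {\<omega> \<in> space M. T (\<rho> \<omega>) \<omega> = t}"
      using ge by auto
    finally show "{\<omega> \<in> space M. T (\<rho> \<omega>) \<omega> = t} \<in> sets (F t)" .
  next
    fix \<omega> assume "\<omega> \<in> space M"
    then show "T (\<rho> \<omega>) \<omega> \<le> Max (K ` {..N})"
      using K N by (intro order_trans[OF K] Max_ge) auto
  qed
qed

lemma pre_sigma_events: "bstime \<rho> \<Longrightarrow> A \<in> sets (pre_sigma \<rho>) \<Longrightarrow> A \<in> events"
proof -
  assume "bstime \<rho>" "A \<in> sets (pre_sigma \<rho>)"
  then have "(\<Union>t. {\<omega> \<in> A. \<rho> \<omega> = t}) \<in> events"
    by (intro sets.countable_UN') (auto intro: sets_F_events simp: sets_pre_sigma_iff_eq bstime_stopping_time)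
  also have "(\<Union>t. {\<omega> \<in> A. \<rho> \<omega> = t}) = A" by auto
  finally show ?thesis .
qed

end

section \<open>Consistent colourings\<close>

locale colouring = filtered_prob_space M F
  for M :: "'a measure" and F :: "nat \<Rightarrow> 'a measure" +
  fixes C :: "'c set" and c :: "nat \<Rightarrow> ('a \<Rightarrow> nat) \<Rightarrow> 'a \<Rightarrow> 'c"
  assumes NT: "NT_function M F (count_space UNIV) c"
    and valued: "valued_in M F C c"
    and consist: "consistent M F c"
begin

lemma colour_in: "bstime \<tau> \<Longrightarrow> \<omega> \<in> space M \<Longrightarrow> n < \<tau> \<omega> \<Longrightarrow> c n \<tau> \<omega> \<in> C"
  using valued by (auto simp: valued_in_def)

lemma colour_sets:
  assumes "bstime \<tau>"
  shows "{\<omega> \<in> space M. n < \<tau> \<omega> \<and> c n \<tau> \<omega> \<in> X} \<in> sets (F n)"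
proof -
  let ?D = "{\<omega> \<in> space M. n < \<tau> \<omega>}"
  have D: "?D \<in> sets (F n)" by (rule bstime_gt_sets[OF assms])
  have "c n \<tau> \<in> restrict_space (F n) ?D \<rightarrow>\<^sub>M count_space UNIV"
    using NT assms by (auto simp: NT_function_def)
  then have "c n \<tau> -` X \<inter> space (restrict_space (F n) ?D) \<in> sets (restrict_space (F n) ?D)"
    by (rule measurable_sets) simp
  then have "c n \<tau> -` X \<inter> ?D \<in> sets (F n)"
    using D by (simp add: space_restrict_space space_F sets_restrict_space_iff Int_absorb2 Int_absorb1 Collect_mono)
  also have "c n \<tau> -` X \<inter> ?D = {\<omega> \<in> space M. n < \<tau> \<omega> \<and> c n \<tau> \<omega> \<in> X}" by auto
  finally show ?thesis .
qed

lemma colour_cong_AE: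
  assumes "A \<in> sets (F n)" "bstime \<tau>\<^sub>1" "bstime \<tau>\<^sub>2"
    and "AE \<omega> in M. \<omega> \<in> A \<longrightarrow> \<tau>\<^sub>1 \<omega> = \<tau>\<^sub>2 \<omega> \<and> n < \<tau>\<^sub>2 \<omega>"
  shows "AE \<omega> in M. \<omega> \<in> A \<longrightarrow> c n \<tau>\<^sub>1 \<omega> = c n \<tau>\<^sub>2 \<omega>"
  using consist assms by (auto simp: consistent_def holds_on_def)

lemma colour_cong:
  assumes "A \<in> sets (F n)" "bstime \<tau>\<^sub>1" "bstime \<tau>\<^sub>2" "\<And>\<omega>. \<omega> \<in> A \<Longrightarrow> \<tau>\<^sub>1 \<omega> = \<tau>\<^sub>2 \<omega> \<and> n < \<tau>\<^sub>2 \<omega>"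
  shows "AE \<omega> in M. \<omega> \<in> A \<longrightarrow> c n \<tau>\<^sub>1 \<omega> = c n \<tau>\<^sub>2 \<omega>"
  using assms by (intro colour_cong_AE) auto

text \<open>Consistency speaks of a fixed index. Cutting \<open>A\<close> along the values m of
  \<rho> gives pieces in \<open>F m\<close>, and the countably many null sets are merged.\<close>

lemma NT_at_cong_AE:
  assumes \<rho>: "bstime \<rho>" and A: "A \<in> sets (pre_sigma \<rho>)" and \<tau>: "bstime \<tau>\<^sub>1" "bstime \<tau>\<^sub>2"
    and eq: "AE \<omega> in M. \<omega> \<in> A \<longrightarrow> \<tau>\<^sub>1 \<omega> = \<tau>\<^sub>2 \<omega> \<and> \<rho> \<omega> < \<tau>\<^sub>2 \<omega>"
  shows "AE \<omega> in M. \<omega> \<in> A \<longrightarrow> NT_at c \<rho> \<tau>\<^sub>1 \<omega> = NT_at c \<rho> \<tau>\<^sub>2 \<omega>"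
proof -
  have "AE \<omega> in M. \<omega> \<in> {\<omega> \<in> A. \<rho> \<omega> = m} \<longrightarrow> c m \<tau>\<^sub>1 \<omega> = c m \<tau>\<^sub>2 \<omega>" for m
  proof (rule colour_cong_AE[OF _ \<tau>])
    show "{\<omega> \<in> A. \<rho> \<omega> = m} \<in> sets (F m)"
      using A sets_pre_sigma_iff_eq[OF bstime_stopping_time[OF \<rho>]] by blast
    show "AE \<omega> in M. \<omega> \<in> {\<omega> \<in> A. \<rho> \<omega> = m} \<longrightarrow> \<tau>\<^sub>1 \<omega> = \<tau>\<^sub>2 \<omega> \<and> m < \<tau>\<^sub>2 \<omega>"
      using eq by eventually_elim auto
  qed
  then have "AE \<omega> in M. \<forall>m. \<omega> \<in> {\<omega> \<in> A. \<rho> \<omega> = m} \<longrightarrow> c m \<tau>\<^sub>1 \<omega> = c m \<tau>\<^sub>2 \<omega>"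
    by (subst AE_all_countable) blast
  then show ?thesis
    by eventually_elim (auto simp: NT_at_def)
qed

text \<open>Where \<rho> = m, the random colour is the one of index m, which \<open>F m\<close>
  knows. This will make the sampled colouring adapted to the sampled filtration.\<close>

lemma NT_at_sets:
  assumes \<rho>: "bstime \<rho>" and \<tau>: "bstime \<tau>"
  shows "{\<omega> \<in> space M. \<rho> \<omega> < \<tau> \<omega> \<and> NT_at c \<rho> \<tau> \<omega> \<in> X} \<in> sets (pre_sigma \<rho>)"
proof -
  have "{\<omega> \<in> space M. \<rho> \<omega> = m} \<inter> {\<omega> \<in> space M. m < \<tau> \<omega> \<and> c m \<tau> \<omega> \<in> X} \<in> sets (F m)" for m
    using colour_sets[OF \<tau>] bstime_eq_sets[OF \<rho>] by (rule sets.Int[rotated])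
  moreover have "{\<omega> \<in> space M. \<rho> \<omega> = m} \<inter> {\<omega> \<in> space M. m < \<tau> \<omega> \<and> c m \<tau> \<omega> \<in> X}
    = {\<omega> \<in> {\<omega> \<in> space M. \<rho> \<omega> < \<tau> \<omega> \<and> NT_at c \<rho> \<tau> \<omega> \<in> X}. \<rho> \<omega> = m}" for m
    by (auto simp: NT_at_def)
  ultimately show ?thesis
    by (subst sets_pre_sigma_iff_eq[OF bstime_stopping_time[OF \<rho>]]) auto
qed

text \<open>The type of colours is arbitrary, so equality of two random colours is written as a
  union over the finitely many values in \<open>C\<close>. Strict increase keeps every colour inside
  its domain.\<close>

lemma monochromatic_events:
  assumes C: "finite C" and \<theta>: "\<And>k. bstime (\<theta> k)" and lt: "\<And>k \<omega>. \<omega> \<in> space M \<Longrightarrow> \<theta> k \<omega> < \<theta> (Suc k) \<omega>"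
  shows "{\<omega> \<in> space M. \<forall>k. NT_at c (\<theta> k) (\<theta> (Suc k)) \<omega> = NT_at c (\<theta> (Suc k)) (\<theta> (Suc (Suc k))) \<omega>} \<in> events"
proof -
  define X where "X k x = {\<omega> \<in> space M. \<theta> k \<omega> < \<theta> (Suc k) \<omega> \<and> NT_at c (\<theta> k) (\<theta> (Suc k)) \<omega> \<in> {x}}" for k x
  have X: "X k x \<in> events" for k x
    unfolding X_def by (rule pre_sigma_events[OF \<theta> NT_at_sets[OF \<theta> \<theta>]])
  have "(\<Inter>k. \<Union>x\<in>C. X k x \<inter> X (Suc k) x) \<in> events"
    using C X by (intro sets.countable_INT sets.finite_UN) auto
  also have "(\<Inter>k. \<Union>x\<in>C. X k x \<inter> X (Suc k) x)
    = {\<omega> \<in> space M. \<forall>k. NT_at c (\<theta> k) (\<theta> (Suc k)) \<omega> = NT_at c (\<theta> (Suc k)) (\<theta> (Suc (Suc k))) \<omega>}"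
    using lt colour_in[OF \<theta>] by (fastforce simp: X_def NT_at_def)
  finally show ?thesis .
qed

end

section \<open>Essential unions\<close>

context prob_space
begin

lemma prob_union_remainder:
  assumes X: "\<And>i::nat. X i \<in> events" and e: "0 < e"
  shows "\<exists>k. prob ((\<Union>i. X i) - (\<Union>i<k. X i)) < e"
proof -
  let ?D = "\<lambda>k. (\<Union>i. X i) - (\<Union>i<k. X i)"
  have "(\<lambda>k. prob (?D k)) \<longlonglongrightarrow> prob (\<Inter>k. ?D k)"
  proof (rule finite_Lim_measure_decseq)
    show "range ?D \<subseteq> events"
      using X by auto
    show "decseq ?D"
      by (auto simp: decseq_def)
  qed
  also have "(\<Inter>k. ?D k) = {}"
    by auto
  finally have "(\<lambda>k. prob (?D k)) \<longlonglongrightarrow> 0"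
    by simp
  then have "\<forall>\<^sub>F k in sequentially. prob (?D k) < e"
    using e by (rule order_tendstoD)
  then show ?thesis
    by (auto simp: eventually_sequentially)
qed

lemma prob_UN_le_geometric:
  assumes X: "\<And>i::nat. X i \<in> events" and le: "\<And>i. prob (X i) \<le> e * (1/2) ^ Suc i"
  shows "prob (\<Union>i. X i) \<le> e"
proof -
  have sums: "(\<lambda>i. e * (1/2) ^ Suc i) sums (e * 1)"
    by (rule sums_mult[OF power_half_series])
  have summ: "summable (\<lambda>i. prob (X i))"
    by (rule summable_comparison_test'[OF sums_summable[OF sums], of 0]) (use le in auto)
  have "prob (\<Union>i. X i) \<le> (\<Sum>i. prob (X i))"
    using X summ by (intro finite_measure_subadditive_countably) auto
  also have "\<dots> \<le> (\<Sum>i. e * (1/2) ^ Suc i)"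
    by (rule suminf_le[OF le summ sums_summable[OF sums]])
  also have "\<dots> = e"
    using sums_unique[OF sums] by simp
  finally show ?thesis .
qed

text \<open>The family may be uncountable, so its plain union need not be measurable. A sequence
  with probabilities approaching the supremum \<open>s\<close> suffices: by directedness its union
  cannot exceed \<open>s\<close>, and a member sticking out of that union would force some member
  above \<open>s\<close>.\<close>

lemma directed_essential_union:
  assumes "I \<noteq> {}" and E: "\<And>i. i \<in> I \<Longrightarrow> E i \<in> events"
    and directed: "\<And>i j. i \<in> I \<Longrightarrow> j \<in> I \<Longrightarrow> \<exists>k\<in>I. AE \<omega> in M. \<omega> \<in> E i \<union> E j \<longrightarrow> \<omega> \<in> E k"
  obtains f :: "nat \<Rightarrow> 'i" where "range f \<subseteq> I"
    and "\<And>i. i \<in> I \<Longrightarrow> AE \<omega> in M. \<omega> \<in> E i \<longrightarrow> \<omega> \<in> (\<Union>n. E (f n))"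
    and "\<And>\<delta>. 0 < \<delta> \<Longrightarrow> \<exists>n. prob ((\<Union>n. E (f n)) - E (f n)) < \<delta>"
proof -
  define s where "s = (SUP i\<in>I. prob (E i))"
  have le_s: "prob (E i) \<le> s" if "i \<in> I" for i
    unfolding s_def using that by (intro cSUP_upper) (auto intro!: bdd_aboveI[of _ 1])
  have "\<exists>i\<in>I. s - inverse (real (Suc n)) < prob (E i)" for n
  proof -
    have "s - inverse (real (Suc n)) < Sup ((\<lambda>i. prob (E i)) ` I)"
      by (simp add: s_def)
    from less_cSupD[OF _ this] show ?thesis
      using assms(1) by auto
  qed
  then obtain f where f: "\<And>n. f n \<in> I" "\<And>n. s - inverse (real (Suc n)) < prob (E (f n))"
    by metis
  define R where "R = (\<Union>n. E (f n))"
  have R: "R \<in> events"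
    unfolding R_def using E f by auto
  have "prob R \<le> s"
  proof -
    \<comment> \<open>Each finite union is absorbed, up to a null set, by a single member, so its
      probability is at most \<open>s\<close>.\<close>
    have *: "\<exists>i\<in>I. AE \<omega> in M. \<omega> \<in> (\<Union>j\<le>n. E (f j)) \<longrightarrow> \<omega> \<in> E i" for n
    proof (induction n)
      case 0
      then show ?case using f by (intro bexI[of _ "f 0"]) auto
    next
      case (Suc n)
      then obtain i where i: "i \<in> I" "AE \<omega> in M. \<omega> \<in> (\<Union>j\<le>n. E (f j)) \<longrightarrow> \<omega> \<in> E i" by blast
      obtain k where k: "k \<in> I" "AE \<omega> in M. \<omega> \<in> E i \<union> E (f (Suc n)) \<longrightarrow> \<omega> \<in> E k"
        using directed[OF i(1) f(1)] by blast
      from i(2) k(2) have "AE \<omega> in M. \<omega> \<in> (\<Union>j\<le>Suc n. E (f j)) \<longrightarrow> \<omega> \<in> E k"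
        by eventually_elim (auto simp: atMost_Suc)
      then show ?case using k by blast
    qed
    have "prob (\<Union>j\<le>n. E (f j)) \<le> s" for n
    proof -
      obtain i where i: "i \<in> I" "AE \<omega> in M. \<omega> \<in> (\<Union>j\<le>n. E (f j)) \<longrightarrow> \<omega> \<in> E i"
        using * by blast
      show ?thesis
        using finite_measure_mono_AE[OF i(2) E[OF i(1)]] le_s[OF i(1)] by simp
    qed
    moreover have "(\<lambda>n. prob (\<Union>j\<le>n. E (f j))) \<longlonglongrightarrow> prob (\<Union>n. \<Union>j\<le>n. E (f j))"
      using E f by (intro finite_Lim_measure_incseq) (auto simp: incseq_def, meson atMost_iff order_trans)
    moreover have "(\<Union>n. \<Union>j\<le>n. E (f j)) = R"
      by (auto simp: R_def)
    ultimately show ?thesis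
      by (intro LIMSEQ_le_const2) auto
  qed
  show ?thesis
  proof (rule that[of f])
    show "range f \<subseteq> I" using f by auto
  next
    fix i assume i: "i \<in> I"
    have "prob (E i - R) \<le> inverse (real (Suc m))" for m
    proof -
      obtain k where k: "k \<in> I" "AE \<omega> in M. \<omega> \<in> E i \<union> E (f m) \<longrightarrow> \<omega> \<in> E k"
        using directed[OF i f(1)] by blast
      \<comment> \<open>The part of \<open>E i\<close> outside \<open>E (f m)\<close> is what a
        common upper member gains over \<open>E (f m)\<close>, and this gain is at most the gap up
        to \<open>s\<close>.\<close>
      have "prob (E i - R) \<le> prob (E i - E (f m))"
        using E i f by (intro finite_measure_mono) (auto simp: R_def)
      also have "\<dots> = prob (E i \<union> E (f m)) - prob (E (f m))"
        using finite_measure_Union'[of "E (f m)" "E i"] E i f by (simp add: Un_commute)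
      also have "\<dots> \<le> s - prob (E (f m))"
        using finite_measure_mono_AE[OF k(2) E[OF k(1)]] le_s[OF k(1)] by simp
      also have "\<dots> \<le> inverse (real (Suc m))"
        using f(2)[of m] by simp
      finally show ?thesis .
    qed
    then have "prob (E i - R) \<le> 0"
      by (intro LIMSEQ_le_const[OF LIMSEQ_inverse_real_of_nat]) auto
    then have "prob (E i - R) = 0"
      using measure_nonneg[of M "E i - R"] by linarith
    then have "AE \<omega> in M. \<omega> \<notin> E i - R"
      using E[OF i] R by (subst (asm) prob_eq_0) auto
    then show "AE \<omega> in M. \<omega> \<in> E i \<longrightarrow> \<omega> \<in> (\<Union>n. E (f n))"
      by eventually_elim (auto simp: R_def)
  next
    fix \<delta> :: real assume "0 < \<delta>"
    then obtain m where m: "inverse (real (Suc m)) < \<delta>"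
      using reals_Archimedean by blast
    have "prob (R - E (f m)) = prob R - prob (E (f m))"
      using E f R by (intro finite_measure_Diff) (auto simp: R_def)
    also have "\<dots> < \<delta>"
      using f(2)[of m] m \<open>prob R \<le> s\<close> by linarith
    finally show "\<exists>n. prob ((\<Union>n. E (f n)) - E (f n)) < \<delta>"
      by (auto simp: R_def)
  qed
qed

end

context colouring
begin

definition coloured :: "nat \<Rightarrow> 'c \<Rightarrow> ('a \<Rightarrow> nat) \<Rightarrow> 'a set"
  where "coloured n r \<tau> = {\<omega> \<in> space M. n < \<tau> \<omega> \<and> c n \<tau> \<omega> = r}"

lemma coloured_sets: "bstime \<tau> \<Longrightarrow> coloured n r \<tau> \<in> sets (F n)"
  using colour_sets[of \<tau> n "{r}"] by (simp add: coloured_def)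

text \<open>Follow \<open>\<tau>\<^sub>1\<close> where it yields \<open>r\<close>, an event of
  \<open>F n\<close>, and \<open>\<tau>\<^sub>2\<close> elsewhere; consistency on the two pieces
  preserves both colours. The maximum with \<open>Suc n\<close> pushes the time past n everywhere
  and leaves \<open>\<tau>\<^sub>2\<close> alone where it is past n already.\<close>

lemma coloured_directed:
  assumes "bstime \<tau>\<^sub>1" "bstime \<tau>\<^sub>2"
  shows "\<exists>\<tau>. bstime \<tau> \<and> (\<forall>\<omega>\<in>space M. n < \<tau> \<omega>) \<and>
    (AE \<omega> in M. \<omega> \<in> coloured n r \<tau>\<^sub>1 \<union> coloured n r \<tau>\<^sub>2 \<longrightarrow> \<omega> \<in> coloured n r \<tau>)"
proof -
  let ?A = "coloured n r \<tau>\<^sub>1"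
  let ?m = "\<lambda>\<omega>. max (\<tau>\<^sub>2 \<omega>) (Suc n)"
  define \<tau> where "\<tau> \<omega> = (if \<omega> \<in> ?A then \<tau>\<^sub>1 \<omega> else ?m \<omega>)" for \<omega>
  have \<tau>: "bstime \<tau>"
    unfolding \<tau>_def using assms
    by (intro bstime_if[of _ n] coloured_sets bstime_max bstime_const) (auto simp: coloured_def)
  have "AE \<omega> in M. \<omega> \<in> ?A \<longrightarrow> c n \<tau> \<omega> = c n \<tau>\<^sub>1 \<omega>"
    using assms \<tau> by (intro colour_cong coloured_sets) (auto simp: \<tau>_def coloured_def)
  moreover have "AE \<omega> in M. \<omega> \<in> {\<omega> \<in> space M. n < \<tau>\<^sub>2 \<omega>} - ?A \<longrightarrow> c n \<tau> \<omega> = c n \<tau>\<^sub>2 \<omega>"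
    using assms \<tau> by (intro colour_cong sets.Diff coloured_sets bstime_gt_sets) (auto simp: \<tau>_def)
  ultimately have "AE \<omega> in M. \<omega> \<in> coloured n r \<tau>\<^sub>1 \<union> coloured n r \<tau>\<^sub>2 \<longrightarrow> \<omega> \<in> coloured n r \<tau>"
    by eventually_elim (auto simp: coloured_def \<tau>_def)
  moreover have "\<forall>\<omega>\<in>space M. n < \<tau> \<omega>"
    by (auto simp: \<tau>_def coloured_def)
  ultimately show ?thesis
    using \<tau> by blast
qed

text \<open>The approximating times are past n on the whole space, so that they can be iterated
  later; the upper bound nevertheless covers every bounded time.\<close>

lemma essential_colour_set:
  obtains R where "R \<in> sets (F n)"
    and "\<And>\<tau>. bstime \<tau> \<Longrightarrow> AE \<omega> in M. \<omega> \<in> coloured n r \<tau> \<longrightarrow> \<omega> \<in> R"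
    and "\<And>\<delta>. 0 < \<delta> \<Longrightarrow> \<exists>\<tau>. bstime \<tau> \<and> (\<forall>\<omega>\<in>space M. n < \<tau> \<omega>) \<and> prob (R - coloured n r \<tau>) < \<delta>"
proof -
  let ?I = "{\<tau>. bstime \<tau> \<and> (\<forall>\<omega>\<in>space M. n < \<tau> \<omega>)}"
  have ne: "?I \<noteq> {}"
    using bstime_const[of "Suc n"] by (intro ex_in_conv[THEN iffD1] exI[of _ "\<lambda>_. Suc n"]) auto
  show ?thesis
  proof (rule directed_essential_union[OF ne, of "coloured n r"])
    show "coloured n r i \<in> events" if "i \<in> ?I" for i
      using that coloured_sets sets_F_events by blast
    show "\<exists>k\<in>?I. AE \<omega> in M. \<omega> \<in> coloured n r i \<union> coloured n r j \<longrightarrow> \<omega> \<in> coloured n r k"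
      if "i \<in> ?I" "j \<in> ?I" for i j
      using coloured_directed[of i j n r] that by blast
  next
    fix f :: "nat \<Rightarrow> 'a \<Rightarrow> nat"
    assume f: "range f \<subseteq> ?I"
      and upper: "\<And>i. i \<in> ?I \<Longrightarrow> AE \<omega> in M. \<omega> \<in> coloured n r i \<longrightarrow> \<omega> \<in> (\<Union>k. coloured n r (f k))"
      and approx: "\<And>\<delta>. 0 < \<delta> \<Longrightarrow> \<exists>k. prob ((\<Union>k. coloured n r (f k)) - coloured n r (f k)) < \<delta>"
    show ?thesis
    proof (rule that)
      show "(\<Union>k. coloured n r (f k)) \<in> sets (F n)"
        using f coloured_sets[of _ n r] by (intro sets.countable_UN) auto
    next
      fix \<tau> assume \<tau>: "bstime \<tau>"
      \<comment> \<open>Pasting \<tau> with itself gives a time past n everywhere that keeps colour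
        \<open>r\<close> up to a null set.\<close>
      obtain \<tau>' where \<tau>': "\<tau>' \<in> ?I" "AE \<omega> in M. \<omega> \<in> coloured n r \<tau> \<union> coloured n r \<tau> \<longrightarrow> \<omega> \<in> coloured n r \<tau>'"
        using coloured_directed[OF \<tau> \<tau>, of n r] by blast
      from upper[OF \<tau>'(1)] \<tau>'(2)
      show "AE \<omega> in M. \<omega> \<in> coloured n r \<tau> \<longrightarrow> \<omega> \<in> (\<Union>k. coloured n r (f k))"
        by eventually_elim blast
    next
      fix \<delta> :: real assume "0 < \<delta>"
      then obtain k where "prob ((\<Union>k. coloured n r (f k)) - coloured n r (f k)) < \<delta>"
        using approx by blast
      then show "\<exists>\<tau>. bstime \<tau> \<and> (\<forall>\<omega>\<in>space M. n < \<tau> \<omega>) \<and> prob ((\<Union>k. coloured n r (f k)) - coloured n r \<tau>) < \<delta>"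
        using f by (intro exI[of _ "f k"]) auto
    qed
  qed
qed

end

section \<open>The dichotomy for one colour\<close>

context filtered_prob_space
begin

lemma sets_F_pre_sigma:
  assumes "A \<in> sets (F n)" "bstime \<rho>" "\<And>\<omega>. \<omega> \<in> A \<Longrightarrow> n \<le> \<rho> \<omega>"
  shows "A \<in> sets (pre_sigma \<rho>)"
proof -
  have sub: "A \<subseteq> space M"
    using sets.sets_into_space[OF assms(1)] by (simp add: space_F)
  have "{\<omega> \<in> A. \<rho> \<omega> = t} \<in> sets (F t)" for t
  proof (cases "n \<le> t")
    case True
    have "A \<inter> {\<omega> \<in> space M. \<rho> \<omega> = t} \<in> sets (F t)"
      using sets_F_le[OF assms(1) True] bstime_eq_sets[OF assms(2)] by (rule sets.Int)
    also have "A \<inter> {\<omega> \<in> space M. \<rho> \<omega> = t} = {\<omega> \<in> A. \<rho> \<omega> = t}"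
      using sub by auto
    finally show ?thesis .
  next
    case False
    then have "{\<omega> \<in> A. \<rho> \<omega> = t} = {}"
      using assms(3) by force
    then show ?thesis by (simp only: sets.empty_sets)
  qed
  then show ?thesis
    using sub by (simp add: sets_pre_sigma_iff_eq[OF bstime_stopping_time[OF assms(2)]])
qed

text \<open>The clause \<open>Suc n = b\<close> keeps the time bounded when the window has no visit.\<close>

definition first_visit :: "(nat \<Rightarrow> 'a set) \<Rightarrow> nat \<Rightarrow> nat \<Rightarrow> 'a \<Rightarrow> nat"
  where "first_visit B a b \<omega> = Inf {n. a \<le> n \<and> (\<omega> \<in> B n \<or> Suc n = b)}"

lemma first_visit:
  assumes "a < b"
  shows "a \<le> first_visit B a b \<omega>" "first_visit B a b \<omega> < b"
    and "i \<in> {a..<b} \<Longrightarrow> \<omega> \<in> B i \<Longrightarrow> \<omega> \<in> B (first_visit B a b \<omega>)"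
proof -
  let ?S = "{n. a \<le> n \<and> (\<omega> \<in> B n \<or> Suc n = b)}"
  have last: "b - 1 \<in> ?S"
    using assms by auto
  then have S: "first_visit B a b \<omega> \<in> ?S"
    unfolding first_visit_def by (intro Inf_nat_def1) blast
  have least: "first_visit B a b \<omega> \<le> i" if "i \<in> ?S" for i
    unfolding first_visit_def using that by (rule cInf_lower) simp
  from S have in_S: "a \<le> first_visit B a b \<omega>" "\<omega> \<in> B (first_visit B a b \<omega>) \<or> Suc (first_visit B a b \<omega>) = b"
    by auto
  then show "a \<le> first_visit B a b \<omega>" "first_visit B a b \<omega> < b"
    using least[OF last] assms by linarith+
  assume "i \<in> {a..<b}" "\<omega> \<in> B i"
  then have "first_visit B a b \<omega> \<le> i"
    by (intro least) auto
  \<comment> \<open>A stop strictly before i comes before the end of the window, so it must be a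
    genuine visit.\<close>
  then show "\<omega> \<in> B (first_visit B a b \<omega>)"
    using in_S(2) \<open>i \<in> {a..<b}\<close> \<open>\<omega> \<in> B i\<close> by (cases "first_visit B a b \<omega> = i") auto
qed

lemma bstime_first_visit:
  assumes "a < b" and B: "\<And>n. B n \<in> sets (F n)"
  shows "bstime (first_visit B a b)"
proof -
  have "stopping_time F (\<lambda>\<omega>. Inf {n. a \<le> n \<and> (\<omega> \<in> B n \<or> Suc n = b)})"
  proof (rule stopping_time_Inf_nat)
    show "filtration (space M) F" by unfold_locales
    show "\<exists>n. a \<le> n \<and> (\<omega> \<in> B n \<or> Suc n = b)" for \<omega>
      using assms(1) by (intro exI[of _ "b - 1"]) auto
    show "Measurable.pred (F n) (\<lambda>\<omega>. a \<le> n \<and> (\<omega> \<in> B n \<or> Suc n = b))" for n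
      using B[of n] by measurable
  qed
  then have "stopping_time F (first_visit B a b)"
    unfolding first_visit_def .
  then show ?thesis
    using first_visit(2)[OF assms(1), of B]
    by (auto simp: bounded_stopping_time_def intro!: exI[of _ b] less_imp_le)
qed

text \<open>Since \<open>B\<close> recurs on \<open>A\<close>, a window opened at any
  \<open>a\<close> misses all visits with arbitrarily small probability once it is closed late
  enough. The windows are then laid end to end.\<close>

lemma ex_windows:
  assumes A: "A \<in> events" "\<And>n. B n \<in> events" and io: "\<And>n. A \<subseteq> (\<Union>i. B (n + i))"
    and \<delta>: "\<And>k::nat. 0 < \<delta> k"
  shows "\<exists>T::nat \<Rightarrow> nat. T 0 = n\<^sub>0 \<and> (\<forall>k. T k < T (Suc k) \<and> prob (A - (\<Union>i\<in>{T k..<T (Suc k)}. B i)) < \<delta> k)"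
proof -
  have "\<exists>b>a. prob (A - (\<Union>i\<in>{a..<b}. B i)) < \<delta> k" for a k
  proof -
    obtain j where j: "prob ((\<Union>i. B (a + i)) - (\<Union>i<j. B (a + i))) < \<delta> k"
      using prob_union_remainder[of "\<lambda>i. B (a + i)", OF A(2) \<delta>] by blast
    \<comment> \<open>\<open>Suc j\<close> in place of \<open>j\<close> keeps the window
      nonempty.\<close>
    have "A - (\<Union>i\<in>{a..<a + Suc j}. B i) \<subseteq> (\<Union>i. B (a + i)) - (\<Union>i<j. B (a + i))"
      using io[of a] by fastforce
    then have "prob (A - (\<Union>i\<in>{a..<a + Suc j}. B i)) \<le> prob ((\<Union>i. B (a + i)) - (\<Union>i<j. B (a + i)))"
      using A by (intro finite_measure_mono sets.Diff sets.countable_UN) auto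
    with j show ?thesis
      by (intro exI[of _ "a + Suc j"]) auto
  qed
  then obtain b where b: "\<And>a k. a < b a k" "\<And>a k. prob (A - (\<Union>i\<in>{a..<b a k}. B i)) < \<delta> k"
    by metis
  define T where "T = rec_nat n\<^sub>0 (\<lambda>k t. b t k)"
  have "T 0 = n\<^sub>0" "\<And>k. T (Suc k) = b (T k) k"
    by (simp_all add: T_def)
  then show ?thesis
    using b by (intro exI[of _ T]) simp
qed

end

context prob_space
begin

text \<open>The limit superior is in general not decided at a finite time. It is the decreasing
  limit of the tail unions, so some tail union exceeds it only slightly, and finitely many terms
  almost exhaust that tail union.\<close>

lemma ex_finite_stage_limsup:
  assumes B: "\<And>n::nat. B n \<in> events" and e: "0 < e"
  obtains n\<^sub>1 j where "prob ((\<Union>i<j. B (n\<^sub>1 + i)) - (\<Inter>n. \<Union>i. B (n + i))) < e"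
    and "prob ((\<Union>i. B (n\<^sub>1 + i)) - (\<Union>i<j. B (n\<^sub>1 + i))) < e"
proof -
  let ?U = "\<lambda>n. \<Union>i. B (n + i)" and ?A = "\<Inter>n. \<Union>i. B (n + i)"
  have U: "?U n \<in> events" for n
    using B by auto
  have "(\<lambda>n. prob (?U n)) \<longlonglongrightarrow> prob ?A"
  proof (rule finite_Lim_measure_decseq)
    show "range ?U \<subseteq> events" using U by blast
    show "decseq ?U"
    proof (rule decseq_SucI, rule UN_least)
      fix n i
      show "B (Suc n + i) \<subseteq> ?U n"
        by (rule order_trans[OF _ UN_upper[of "Suc i"]]) auto
    qed
  qed
  then have "\<forall>\<^sub>F n in sequentially. prob (?U n) < prob ?A + e"
    using e by (intro order_tendstoD) auto
  then obtain n\<^sub>1 where n1: "prob (?U n\<^sub>1) < prob ?A + e"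
    by (auto simp: eventually_sequentially)
  obtain j where j: "prob (?U n\<^sub>1 - (\<Union>i<j. B (n\<^sub>1 + i))) < e"
    using prob_union_remainder[of "\<lambda>i. B (n\<^sub>1 + i)", OF B e] by blast
  have A: "?A \<in> events" using U by (intro sets.countable_INT) auto
  have "prob ((\<Union>i<j. B (n\<^sub>1 + i)) - ?A) \<le> prob (?U n\<^sub>1 - ?A)"
    using A U by (intro finite_measure_mono) auto
  also have "\<dots> = prob (?U n\<^sub>1) - prob ?A"
    using A U by (intro finite_measure_Diff) auto
  also have "\<dots> < e" using n1 by simp
  finally show ?thesis
    using j that by blast
qed

end

context colouring
begin

text \<open>Two strategies are glued along \<open>A\<close>: off \<open>A\<close>, iterate times
  that attain \<open>r\<close>; on \<open>A\<close>, stop at indices where no time attains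
  \<open>r\<close>. All imprecision is charged to one set \<open>Z\<close>, chosen before
  \<open>k\<close> and \<tau>, so it is paid for only once.\<close>

lemma red_or_avoiding:
  assumes e: "0 < e"
  obtains \<sigma> A Z where "\<And>k. bstime (\<sigma> k)" "\<And>k \<omega>. \<omega> \<in> space M \<Longrightarrow> \<sigma> k \<omega> < \<sigma> (Suc k) \<omega>"
    and "A \<in> sets (pre_sigma (\<sigma> 0))" "Z \<in> events" "prob Z < e"
    and "\<And>k. AE \<omega> in M. \<omega> \<in> space M - A - Z \<longrightarrow> NT_at c (\<sigma> k) (\<sigma> (Suc k)) \<omega> = r"
    and "\<And>k \<tau>. bstime \<tau> \<Longrightarrow> AE \<omega> in M. \<omega> \<in> A - Z \<longrightarrow> \<sigma> k \<omega> < \<tau> \<omega> \<longrightarrow> NT_at c (\<sigma> k) \<tau> \<omega> \<noteq> r"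
proof -
  \<comment> \<open>The sum over all k is \<open>e / 5\<close>. Four error sets of at most this size
    will leave a strict margin below \<open>e\<close>.\<close>
  define d where "d k = e / 5 * (1/2) ^ Suc k" for k
  have d: "0 < d k" for k
    using e by (simp add: d_def)
  define ess where "ess n R \<longleftrightarrow> R \<in> sets (F n) \<and>
      (\<forall>\<tau>. bstime \<tau> \<longrightarrow> (AE \<omega> in M. \<omega> \<in> coloured n r \<tau> \<longrightarrow> \<omega> \<in> R))" for n R
  \<comment> \<open>One time per index is fixed in advance, with summable failure probabilities,
    because the indices where these times get used are random.\<close>
  define attains where "attains n R \<tau> \<longleftrightarrow> bstime \<tau> \<and> (\<forall>\<omega>\<in>space M. n < \<tau> \<omega>) \<and>
      prob (R - coloured n r \<tau>) < d n" for n R \<tau>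
  have "\<exists>R \<tau>. ess n R \<and> attains n R \<tau>" for n
  proof (rule essential_colour_set[of n r])
    fix R
    assume "R \<in> sets (F n)"
      and "\<And>\<tau>. bstime \<tau> \<Longrightarrow> AE \<omega> in M. \<omega> \<in> coloured n r \<tau> \<longrightarrow> \<omega> \<in> R"
      and "\<And>\<delta>. 0 < \<delta> \<Longrightarrow> \<exists>\<tau>. bstime \<tau> \<and> (\<forall>\<omega>\<in>space M. n < \<tau> \<omega>) \<and> prob (R - coloured n r \<tau>) < \<delta>"
    then show ?thesis
      using d[of n] by (intro exI[of _ R]) (simp add: ess_def attains_def)
  qed
  then obtain R \<tau> where ess: "\<And>n. ess n (R n)" and attains: "\<And>n. attains n (R n) (\<tau> n)"
    by metis
  have R: "R n \<in> sets (F n)"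
    and R_upper: "bstime \<rho> \<Longrightarrow> AE \<omega> in M. \<omega> \<in> coloured n r \<rho> \<longrightarrow> \<omega> \<in> R n" for n \<rho>
    using ess[of n] by (auto simp: ess_def)
  have \<tau>: "bstime (\<tau> n)" "\<omega> \<in> space M \<Longrightarrow> n < \<tau> n \<omega>"
    and \<tau>_prob: "prob (R n - coloured n r (\<tau> n)) < d n" for n \<omega>
    using attains[of n] by (auto simp: attains_def)
  define B where "B n = space M - R n" for n
  have B: "B n \<in> sets (F n)" for n
    unfolding B_def by (rule sets_F_Compl[OF R])
  have B_ev: "B n \<in> events" for n
    by (rule sets_F_events[OF B])
  define L where "L = (\<Inter>n. \<Union>i. B (n + i))"
  have L: "L \<in> events"
    unfolding L_def using B_ev by auto
  obtain n\<^sub>1 j where n1: "prob ((\<Union>i<j. B (n\<^sub>1 + i)) - L) < e / 5"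
    "prob ((\<Union>i. B (n\<^sub>1 + i)) - (\<Union>i<j. B (n\<^sub>1 + i))) < e / 5"
    using ex_finite_stage_limsup[of B "e / 5", OF B_ev] e unfolding L_def by auto
  define n\<^sub>2 where "n\<^sub>2 = n\<^sub>1 + j"
  define A where "A = (\<Union>i<j. B (n\<^sub>1 + i))"
  \<comment> \<open>All terms of the union have index below \<open>n\<^sub>2\<close>, so
    \<open>A\<close> is decided before either strategy makes its first stop.\<close>
  have A: "A \<in> sets (F n\<^sub>2)"
    unfolding A_def n\<^sub>2_def using sets_F_le[OF B] by (intro sets.countable_UN') auto
  have A_ev: "A \<in> events"
    by (rule sets_F_events[OF A])
  have "L \<subseteq> (\<Union>i. B (n + i))" for n
    unfolding L_def by blast
  from ex_windows[where \<delta> = d and n\<^sub>0 = n\<^sub>2, OF L B_ev this d]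
  obtain T where T: "T 0 = n\<^sub>2" "\<And>k. T k < T (Suc k)"
    "\<And>k. prob (L - (\<Union>i\<in>{T k..<T (Suc k)}. B i)) < d k"
    by blast
  have T_ge: "n\<^sub>2 \<le> T k" for k
  proof (induction k)
    case (Suc k)
    then show ?case using T(2)[of k] by linarith
  qed (simp add: T(1))

  \<comment> \<open>One stop per window; the windows are disjoint and consecutive, which makes the
    stops strictly increasing.\<close>
  define blue where "blue k = first_visit B (T k) (T (Suc k))" for k
  have blue_bounds: "T k \<le> blue k \<omega>" "blue k \<omega> < T (Suc k)" for k \<omega>
    unfolding blue_def using first_visit(1,2)[OF T(2)] by auto
  have blue_ge: "n\<^sub>2 \<le> blue k \<omega>" for k \<omega>
    using T_ge blue_bounds(1) by (rule order_trans)
  have blue: "bstime (blue k)" for k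
    unfolding blue_def by (rule bstime_first_visit[OF T(2) B])
  have blue_mono: "blue k \<omega> < blue (Suc k) \<omega>" for k \<omega>
    using blue_bounds by (rule less_le_trans[rotated])

  \<comment> \<open>From the current random index, the time preselected for that index is
    followed.\<close>
  define red where "red = rec_nat (\<lambda>_. n\<^sub>2) (\<lambda>k \<rho> \<omega>. \<tau> (\<rho> \<omega>) \<omega>)"
  have red_simps: "red 0 = (\<lambda>_. n\<^sub>2)" "\<And>k. red (Suc k) = (\<lambda>\<omega>. \<tau> (red k \<omega>) \<omega>)"
    by (simp_all add: red_def)
  have red: "bstime (red k)" for k
  proof (induction k)
    case 0
    then show ?case by (simp add: red_simps bstime_const)
  next
    case (Suc k)
    then show ?case
      unfolding red_simps by (rule bstime_select) (auto intro: \<tau> less_imp_le)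
  qed
  have red_mono: "red k \<omega> < red (Suc k) \<omega>" if "\<omega> \<in> space M" for k \<omega>
    using \<tau>(2)[OF that] by (simp add: red_simps)
  have red_ge: "n\<^sub>2 \<le> red k \<omega>" if "\<omega> \<in> space M" for k \<omega>
  proof (induction k)
    case (Suc k)
    then show ?case using red_mono[OF that, of k] by linarith
  qed (simp add: red_simps(1))

  define \<sigma> where "\<sigma> k \<omega> = (if \<omega> \<in> A then blue k \<omega> else red k \<omega>)" for k \<omega>
  have \<sigma>_ge: "n\<^sub>2 \<le> \<sigma> k \<omega>" if "\<omega> \<in> space M" for k \<omega>
    using red_ge[OF that] blue_ge[of k \<omega>] by (simp add: \<sigma>_def)
  have \<sigma>: "bstime (\<sigma> k)" for k
    unfolding \<sigma>_def
    by (intro bstime_if[OF A] blue red blue_ge red_ge) auto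
  have \<sigma>_mono: "\<sigma> k \<omega> < \<sigma> (Suc k) \<omega>" if "\<omega> \<in> space M" for k \<omega>
    using blue_mono[of k \<omega>] red_mono[OF that, of k] by (simp add: \<sigma>_def)

  \<comment> \<open>The sources of error: \<open>Z1\<close>, no recurrence of \<open>B\<close>
    although \<open>A\<close> occurs; \<open>Z2\<close>, a visit from \<open>n\<^sub>1\<close> on
    although \<open>A\<close> fails; \<open>Z3\<close>, a preselected time missing \<open>r\<close>
    on its \<open>R n\<close>; \<open>Z4\<close>, a window without a visit despite
    recurrence.\<close>
  define Z1 where "Z1 = A - L"
  define Z2 where "Z2 = (\<Union>i. B (n\<^sub>1 + i)) - A"
  define Z3 where "Z3 = (\<Union>n. R n - coloured n r (\<tau> n))"
  define Z4 where "Z4 = (\<Union>k. L - (\<Union>i\<in>{T k..<T (Suc k)}. B i))"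
  have Z_ev: "Z1 \<in> events" "Z2 \<in> events" "Z3 \<in> events" "Z4 \<in> events"
    unfolding Z1_def Z2_def Z3_def Z4_def
    using A_ev B_ev L sets_F_events[OF R] sets_F_events[OF coloured_sets[OF \<tau>(1)]]
    by (auto intro!: sets.Diff sets.countable_UN sets.finite_UN)
  have Z12: "prob Z1 < e / 5" "prob Z2 < e / 5"
    using n1 by (auto simp: Z1_def Z2_def A_def)
  have Z3: "prob Z3 \<le> e / 5"
    unfolding Z3_def using sets_F_events[OF R] sets_F_events[OF coloured_sets[OF \<tau>(1)]] \<tau>_prob
    by (intro prob_UN_le_geometric) (auto simp: d_def intro: less_imp_le)
  have Z4: "prob Z4 \<le> e / 5"
    unfolding Z4_def using L B_ev T(3)
    by (intro prob_UN_le_geometric) (auto simp: d_def intro: less_imp_le)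
  let ?Z = "Z1 \<union> Z2 \<union> (Z3 \<union> Z4)"
  show ?thesis
  proof (rule that[of \<sigma> A ?Z])
    show "A \<in> sets (pre_sigma (\<sigma> 0))"
      using sets.sets_into_space[OF A_ev] by (intro sets_F_pre_sigma[OF A \<sigma>] \<sigma>_ge) auto
    show "?Z \<in> events" using Z_ev by auto
    have "prob ?Z \<le> prob (Z1 \<union> Z2) + prob (Z3 \<union> Z4)"
      using Z_ev by (intro measure_Un_le) auto
    also have "\<dots> \<le> (prob Z1 + prob Z2) + (prob Z3 + prob Z4)"
      using Z_ev by (intro add_mono measure_Un_le) auto
    also have "\<dots> < e" using Z12 Z3 Z4 e by linarith
    finally show "prob ?Z < e" .
  next
    fix k
    \<comment> \<open>For m from \<open>n\<^sub>2\<close> on this event lies in \<open>F m\<close>,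
      and there the next stop agrees with \<open>\<tau> m\<close>, so consistency transfers the
      colour. Smaller m do not occur.\<close>
    have "AE \<omega> in M. \<omega> \<in> {\<omega> \<in> space M. \<sigma> k \<omega> = m} - A \<longrightarrow> c m (\<sigma> (Suc k)) \<omega> = c m (\<tau> m) \<omega>" for m
    proof (cases "n\<^sub>2 \<le> m")
      case True
      have "\<sigma> (Suc k) \<omega> = \<tau> m \<omega> \<and> m < \<tau> m \<omega>" if "\<omega> \<in> {\<omega> \<in> space M. \<sigma> k \<omega> = m} - A" for \<omega>
        using that \<tau>(2)[of \<omega> m] by (auto simp: \<sigma>_def red_simps)
      then show ?thesis
        by (rule colour_cong[OF sets.Diff[OF bstime_eq_sets[OF \<sigma>] sets_F_le[OF A True]] \<sigma> \<tau>(1)])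
    next
      case False
      then show ?thesis using \<sigma>_ge by auto
    qed
    then have "AE \<omega> in M. \<forall>m. \<omega> \<in> {\<omega> \<in> space M. \<sigma> k \<omega> = m} - A \<longrightarrow> c m (\<sigma> (Suc k)) \<omega> = c m (\<tau> m) \<omega>"
      by (subst AE_all_countable) blast
    then show "AE \<omega> in M. \<omega> \<in> space M - A - ?Z \<longrightarrow> NT_at c (\<sigma> k) (\<sigma> (Suc k)) \<omega> = r"
    proof eventually_elim
      case (elim \<omega>)
      show ?case
      proof
        assume \<omega>: "\<omega> \<in> space M - A - ?Z"
        define m where "m = \<sigma> k \<omega>"
        \<comment> \<open>Outside \<open>A\<close> and \<open>Z2\<close> there is no visit from
          \<open>n\<^sub>1\<close> on, so the current index m has \<omega> in
          \<open>R m\<close>.\<close>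
        have "n\<^sub>1 \<le> m"
          using \<sigma>_ge[of \<omega> k] \<omega> by (simp add: m_def n\<^sub>2_def)
        then have "m = n\<^sub>1 + (m - n\<^sub>1)" by simp
        moreover have "\<omega> \<notin> B (n\<^sub>1 + (m - n\<^sub>1))"
          using \<omega> by (auto simp: Z2_def)
        ultimately have "\<omega> \<in> R m"
          using \<omega> by (auto simp: B_def)
        then have "\<omega> \<in> coloured m r (\<tau> m)"
          using \<omega> by (auto simp: Z3_def)
        then show "NT_at c (\<sigma> k) (\<sigma> (Suc k)) \<omega> = r"
          using elim \<omega> by (auto simp: coloured_def NT_at_def m_def)
      qed
    qed
  next
    fix k \<tau>' assume "bstime \<tau>'"
    \<comment> \<open>The index \<open>\<sigma> k\<close> is random, so a single null set must serve
      all m.\<close>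
    then have "AE \<omega> in M. \<forall>m. \<omega> \<in> coloured m r \<tau>' \<longrightarrow> \<omega> \<in> R m"
      using R_upper by (subst AE_all_countable) blast
    then show "AE \<omega> in M. \<omega> \<in> A - ?Z \<longrightarrow> \<sigma> k \<omega> < \<tau>' \<omega> \<longrightarrow> NT_at c (\<sigma> k) \<tau>' \<omega> \<noteq> r"
    proof eventually_elim
      case (elim \<omega>)
      show ?case
      proof (intro impI)
        assume \<omega>: "\<omega> \<in> A - ?Z" and lt: "\<sigma> k \<omega> < \<tau>' \<omega>"
        \<comment> \<open>Outside \<open>Z1\<close> recurrence holds on \<open>A\<close>, and
          outside \<open>Z4\<close> the k-th window then contains a visit, so the stop is made in
          \<open>B\<close>.\<close>
        then have "\<omega> \<in> L - Z4" by (auto simp: Z1_def)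
        then obtain i where i: "i \<in> {T k..<T (Suc k)}" "\<omega> \<in> B i"
          unfolding Z4_def by blast
        then have "\<omega> \<in> B (\<sigma> k \<omega>)"
          using first_visit(3)[where B = B, OF T(2) i] \<omega> by (simp add: \<sigma>_def blue_def)
        then have "\<omega> \<in> space M" "\<omega> \<notin> coloured (\<sigma> k \<omega>) r \<tau>'"
          using elim by (auto simp: B_def)
        then show "NT_at c (\<sigma> k) \<tau>' \<omega> \<noteq> r"
          using lt by (auto simp: coloured_def NT_at_def)
      qed
    qed
  qed (fact \<sigma>, rule \<sigma>_mono)
qed

end

section \<open>Sampling the filtration\<close>

context filtered_prob_space
begin

lemma NT_functionI:
  assumes "\<And>n \<tau> X. bstime \<tau> \<Longrightarrow> {\<omega> \<in> space M. n < \<tau> \<omega> \<and> f n \<tau> \<omega> \<in> X} \<in> sets (F n)"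
  shows "NT_function M F (count_space UNIV) f"
  unfolding NT_function_def
proof (intro allI impI measurableI)
  fix n \<tau> X assume \<tau>: "bstime \<tau>"
  let ?D = "{\<omega> \<in> space M. n < \<tau> \<omega>}"
  have "?D \<inter> space (F n) \<in> sets (F n)"
    using bstime_gt_sets[OF \<tau>, of n] by (simp add: space_F Int_absorb2 Collect_mono)
  moreover have "f n \<tau> -` X \<inter> space (restrict_space (F n) ?D) = {\<omega> \<in> space M. n < \<tau> \<omega> \<and> f n \<tau> \<omega> \<in> X}"
    by (auto simp: space_restrict_space space_F)
  ultimately show "f n \<tau> -` X \<inter> space (restrict_space (F n) ?D) \<in> sets (restrict_space (F n) ?D)"
    using assms[OF \<tau>] by (auto simp: sets_restrict_space_iff)
qed auto

end

locale sampling = filtered_prob_space M F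
  for M :: "'a measure" and F :: "nat \<Rightarrow> 'a measure" +
  fixes \<sigma> :: "nat \<Rightarrow> 'a \<Rightarrow> nat"
  assumes \<sigma>: "\<And>k. bstime (\<sigma> k)"
    and \<sigma>_Suc: "\<And>k \<omega>. \<omega> \<in> space M \<Longrightarrow> \<sigma> k \<omega> < \<sigma> (Suc k) \<omega>"
begin

abbreviation "G \<equiv> \<lambda>k. pre_sigma (\<sigma> k)"

lemma \<sigma>_less: "\<omega> \<in> space M \<Longrightarrow> i < j \<Longrightarrow> \<sigma> i \<omega> < \<sigma> j \<omega>"
  by (rule lift_Suc_mono_less[of "\<lambda>k. \<sigma> k \<omega>"]) (rule \<sigma>_Suc)

text \<open>The stopped sigma-algebras grow along increasing times, so the results on bounded
  stopping times become available for \<open>G\<close> too.\<close>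

sublocale sampled: filtered_prob_space M G
proof
  show "space (G i) = space M" for i
    by (simp add: space_pre_sigma)
  show "sets (G i) \<subseteq> sets (G j)" if "i \<le> j" for i j
    using that \<sigma>_less by (intro mono_pre_sigma bstime_stopping_time \<sigma>) (auto simp: le_less)
  show "subalgebra M (G n)" for n
    using pre_sigma_events[OF \<sigma>] by (auto simp: subalgebra_def space_pre_sigma)
qed

text \<open>The event \<tau> = k belongs to \<open>G k\<close>, which by the nature of stopped
  sigma-algebras puts its part with \<open>\<sigma> k\<close> = t into \<open>F t\<close>. The bound
  is that of \<open>\<sigma> N\<close>.\<close>

lemma bstime_sample:
  assumes \<tau>: "sampled.bstime \<tau>"
  shows "bstime (\<lambda>\<omega>. \<sigma> (\<tau> \<omega>) \<omega>)"
proof -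
  obtain N where N: "\<And>\<omega>. \<omega> \<in> space M \<Longrightarrow> \<tau> \<omega> \<le> N"
    using sampled.bstimeE[OF \<tau>] by metis
  obtain K where K: "\<And>\<omega>. \<omega> \<in> space M \<Longrightarrow> \<sigma> N \<omega> \<le> K"
    using bstimeE[OF \<sigma>] by metis
  show ?thesis
  proof (rule bstimeI[where N = K])
    fix t
    have "{\<omega> \<in> {\<omega> \<in> space M. \<tau> \<omega> = k}. \<sigma> k \<omega> = t} \<in> sets (F t)" for k
      using sampled.bstime_eq_sets[OF \<tau>, of k] sets_pre_sigma_iff_eq[OF bstime_stopping_time[OF \<sigma>]] by blast
    then have "(\<Union>k. {\<omega> \<in> {\<omega> \<in> space M. \<tau> \<omega> = k}. \<sigma> k \<omega> = t}) \<in> sets (F t)"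
      by (intro sets.countable_UN') auto
    also have "(\<Union>k. {\<omega> \<in> {\<omega> \<in> space M. \<tau> \<omega> = k}. \<sigma> k \<omega> = t}) = {\<omega> \<in> space M. \<sigma> (\<tau> \<omega>) \<omega> = t}"
      by auto
    finally show "{\<omega> \<in> space M. \<sigma> (\<tau> \<omega>) \<omega> = t} \<in> sets (F t)" .
  next
    fix \<omega> assume \<omega>: "\<omega> \<in> space M"
    have "\<sigma> (\<tau> \<omega>) \<omega> \<le> \<sigma> N \<omega>"
      using \<sigma>_less[OF \<omega>, of "\<tau> \<omega>" N] N[OF \<omega>] by (auto simp: le_less)
    then show "\<sigma> (\<tau> \<omega>) \<omega> \<le> K"
      using K[OF \<omega>] by (rule order_trans)
  qed
qed

text \<open>The new index n stands for the time \<open>\<sigma> n\<close>, and the new time \<tau>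
  for \<sigma> evaluated at \<tau>. Measurability and consistency become the random-index statements
  for \<open>c\<close>.\<close>

lemma colouring_sample:
  assumes "colouring M F C c"
  shows "colouring M G C (\<lambda>n \<tau>. NT_at c (\<sigma> n) (\<lambda>\<omega>. \<sigma> (\<tau> \<omega>) \<omega>))"
proof -
  interpret colouring M F C c by fact
  show ?thesis
  proof
    show "NT_function M G (count_space UNIV) (\<lambda>n \<tau>. NT_at c (\<sigma> n) (\<lambda>\<omega>. \<sigma> (\<tau> \<omega>) \<omega>))"
    proof (rule sampled.NT_functionI)
      fix n \<tau> X assume \<tau>: "sampled.bstime \<tau>"
      let ?\<rho> = "\<lambda>\<omega>. \<sigma> (\<tau> \<omega>) \<omega>"
      have "{\<omega> \<in> space M. n < \<tau> \<omega>} \<inter> {\<omega> \<in> space M. \<sigma> n \<omega> < ?\<rho> \<omega> \<and> NT_at c (\<sigma> n) ?\<rho> \<omega> \<in> X} \<in> sets (G n)"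
        using sampled.bstime_gt_sets[OF \<tau>] NT_at_sets[OF \<sigma> bstime_sample[OF \<tau>]] by (rule sets.Int)
      also have "{\<omega> \<in> space M. n < \<tau> \<omega>} \<inter> {\<omega> \<in> space M. \<sigma> n \<omega> < ?\<rho> \<omega> \<and> NT_at c (\<sigma> n) ?\<rho> \<omega> \<in> X}
        = {\<omega> \<in> space M. n < \<tau> \<omega> \<and> NT_at c (\<sigma> n) ?\<rho> \<omega> \<in> X}"
        using \<sigma>_less by auto
      finally show "{\<omega> \<in> space M. n < \<tau> \<omega> \<and> NT_at c (\<sigma> n) ?\<rho> \<omega> \<in> X} \<in> sets (G n)" .
    qed
    show "valued_in M G C (\<lambda>n \<tau>. NT_at c (\<sigma> n) (\<lambda>\<omega>. \<sigma> (\<tau> \<omega>) \<omega>))"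
      using colour_in[OF bstime_sample] \<sigma>_less by (auto simp: valued_in_def NT_at_def)
    show "consistent M G (\<lambda>n \<tau>. NT_at c (\<sigma> n) (\<lambda>\<omega>. \<sigma> (\<tau> \<omega>) \<omega>))"
      unfolding consistent_def holds_on_def
    proof (intro allI ballI impI)
      fix n A \<tau>\<^sub>1 \<tau>\<^sub>2
      assume A: "A \<in> sets (G n)" and \<tau>: "sampled.bstime \<tau>\<^sub>1" "sampled.bstime \<tau>\<^sub>2"
        and eq: "AE \<omega> in M. \<omega> \<in> A \<longrightarrow> \<tau>\<^sub>1 \<omega> = \<tau>\<^sub>2 \<omega> \<and> n < \<tau>\<^sub>2 \<omega>"
      have "AE \<omega> in M. \<omega> \<in> A \<longrightarrow> \<sigma> (\<tau>\<^sub>1 \<omega>) \<omega> = \<sigma> (\<tau>\<^sub>2 \<omega>) \<omega> \<and> \<sigma> n \<omega> < \<sigma> (\<tau>\<^sub>2 \<omega>) \<omega>"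
        using eq AE_space by eventually_elim (auto intro: \<sigma>_less)
      then show "AE \<omega> in M. \<omega> \<in> A \<longrightarrow>
          NT_at c (\<sigma> n) (\<lambda>\<omega>. \<sigma> (\<tau>\<^sub>1 \<omega>) \<omega>) \<omega> = NT_at c (\<sigma> n) (\<lambda>\<omega>. \<sigma> (\<tau>\<^sub>2 \<omega>) \<omega>) \<omega>"
        by (rule NT_at_cong_AE[OF \<sigma> A bstime_sample[OF \<tau>(1)] bstime_sample[OF \<tau>(2)]])
    qed
  qed
qed

end

text \<open>The sampled colouring avoids \<open>r\<close> only on part of the space, whereas the
  induction hypothesis wants colours in \<open>C\<close> everywhere. A substitute \<open>a\<close>
  repairs this and changes nothing where \<open>r\<close> is avoided.\<close>

lemma colouring_recolour:
  assumes "colouring M F (insert r C) c" and "a \<in> C"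
  shows "colouring M F C (\<lambda>n \<tau> \<omega>. if c n \<tau> \<omega> = r then a else c n \<tau> \<omega>)"
proof -
  interpret colouring M F "insert r C" c by fact
  let ?f = "\<lambda>x. if x = r then a else x"
  show ?thesis
  proof
    have "{\<omega> \<in> space M. n < \<tau> \<omega> \<and> ?f (c n \<tau> \<omega>) \<in> X} = {\<omega> \<in> space M. n < \<tau> \<omega> \<and> c n \<tau> \<omega> \<in> ?f -` X}"
      for n \<tau> X by (simp only: vimage_eq)
    then show "NT_function M F (count_space UNIV) (\<lambda>n \<tau> \<omega>. ?f (c n \<tau> \<omega>))"
      by (intro NT_functionI) (simp only: colour_sets)
    show "valued_in M F C (\<lambda>n \<tau> \<omega>. ?f (c n \<tau> \<omega>))"
      using colour_in assms(2) by (fastforce simp: valued_in_def)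
    show "consistent M F (\<lambda>n \<tau> \<omega>. ?f (c n \<tau> \<omega>))"
      unfolding consistent_def holds_on_def
    proof (intro allI ballI impI)
      fix n A \<tau>\<^sub>1 \<tau>\<^sub>2
      assume "A \<in> sets (F n)" "bstime \<tau>\<^sub>1" "bstime \<tau>\<^sub>2"
        and "AE \<omega> in M. \<omega> \<in> A \<longrightarrow> \<tau>\<^sub>1 \<omega> = \<tau>\<^sub>2 \<omega> \<and> n < \<tau>\<^sub>2 \<omega>"
      then have "AE \<omega> in M. \<omega> \<in> A \<longrightarrow> c n \<tau>\<^sub>1 \<omega> = c n \<tau>\<^sub>2 \<omega>"
        by (rule colour_cong_AE)
      then show "AE \<omega> in M. \<omega> \<in> A \<longrightarrow> ?f (c n \<tau>\<^sub>1 \<omega>) = ?f (c n \<tau>\<^sub>2 \<omega>)"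
        by eventually_elim simp
    qed
  qed
qed

section \<open>Induction on the colours\<close>

definition monochromatic ::
  "'a measure \<Rightarrow> (nat \<Rightarrow> ('a \<Rightarrow> nat) \<Rightarrow> 'a \<Rightarrow> 'c) \<Rightarrow> (nat \<Rightarrow> 'a \<Rightarrow> nat) \<Rightarrow> 'a set"
  where "monochromatic M c \<theta> = {\<omega> \<in> space M. \<forall>k.
    NT_at c (\<theta> k) (\<theta> (Suc k)) \<omega> = NT_at c (\<theta> (Suc k)) (\<theta> (Suc (Suc k))) \<omega>}"

lemma stochastic_ramsey:
  assumes "finite C" "colouring M F C c" "0 < e"
  shows "\<exists>\<theta>. (\<forall>k. bounded_stopping_time M F (\<theta> k)) \<and>
    (\<forall>k. \<forall>\<omega>\<in>space M. \<theta> k \<omega> < \<theta> (Suc k) \<omega>) \<and> measure M (monochromatic M c \<theta>) > 1 - e"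
  using assms
\<comment> \<open>The filtration has to vary, because the induction hypothesis is used for the
  sampled one.\<close>
proof (induction C arbitrary: F c e rule: finite_induct)
  case empty
  then interpret colouring M F "{}" c by simp
  \<comment> \<open>With no colours the hypotheses are contradictory: a point of the nonempty space
    has a colour at index 0 for the time 1.\<close>
  obtain \<omega> where "\<omega> \<in> space M"
    using not_empty by blast
  then show ?case
    using colour_in[OF bstime_const[of 1], of \<omega> 0] by simp
next
  case (insert r C)
  interpret colouring M F "insert r C" c by fact
  show ?case
  proof (cases "C = {}")
    \<comment> \<open>Recolouring requires a second colour, so a single colour is treated
      apart.\<close>
    case True
    then have "monochromatic M c (\<lambda>k _. k) = space M"
      using colour_in[OF bstime_const] by (auto simp: monochromatic_def NT_at_def)
    then show ?thesis
      using bstime_const \<open>0 < e\<close> prob_space by (intro exI[of _ "\<lambda>k _. k"]) simp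
  next
    case False
    then obtain a where a: "a \<in> C" by blast
    obtain \<sigma> A Z where \<sigma>: "\<And>k. bstime (\<sigma> k)" "\<And>k \<omega>. \<omega> \<in> space M \<Longrightarrow> \<sigma> k \<omega> < \<sigma> (Suc k) \<omega>"
      and A: "A \<in> sets (pre_sigma (\<sigma> 0))" and Z: "Z \<in> events" "prob Z < e / 2"
      and red: "\<And>k. AE \<omega> in M. \<omega> \<in> space M - A - Z \<longrightarrow> NT_at c (\<sigma> k) (\<sigma> (Suc k)) \<omega> = r"
      and avoid: "\<And>k \<tau>. bstime \<tau> \<Longrightarrow> AE \<omega> in M. \<omega> \<in> A - Z \<longrightarrow> \<sigma> k \<omega> < \<tau> \<omega> \<longrightarrow> NT_at c (\<sigma> k) \<tau> \<omega> \<noteq> r"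
      by (rule red_or_avoiding[OF half_gt_zero[OF \<open>0 < e\<close>], of r]) (rule that, blast+)
    interpret sampling M F \<sigma>
      by unfold_locales (fact \<sigma>)+
    define c' where "c' n \<tau> = NT_at c (\<sigma> n) (\<lambda>\<omega>. \<sigma> (\<tau> \<omega>) \<omega>)" for n \<tau>
    define c'' where "c'' n \<tau> \<omega> = (if c' n \<tau> \<omega> = r then a else c' n \<tau> \<omega>)" for n \<tau> \<omega>
    interpret s1: colouring M G "insert r C" c'
      unfolding c'_def by (rule colouring_sample[OF \<open>colouring M F (insert r C) c\<close>])
    interpret s2: colouring M G C c''
      unfolding c''_def by (rule colouring_recolour[OF s1.colouring_axioms a])
    obtain \<theta> where \<theta>: "\<And>k. sampled.bstime (\<theta> k)" "\<And>k \<omega>. \<omega> \<in> space M \<Longrightarrow> \<theta> k \<omega> < \<theta> (Suc k) \<omega>"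
      and \<theta>_prob: "prob (monochromatic M c'' \<theta>) > 1 - e / 2"
      using insert.IH[OF s2.colouring_axioms, of "e / 2"] \<open>0 < e\<close> by auto
    \<comment> \<open>On \<open>A\<close>, use the times from the induction hypothesis; off
      \<open>A\<close>, take every sampled time in turn, so that the colours are \<open>r\<close>.
      The splice is legitimate because \<open>A\<close> is decided at sampled time 0.\<close>
    define \<eta> where "\<eta> k \<omega> = (if \<omega> \<in> A then \<theta> k \<omega> else k)" for k \<omega>
    have \<eta>: "sampled.bstime (\<eta> k)" for k
      unfolding \<eta>_def by (rule sampled.bstime_if[OF A \<theta>(1) sampled.bstime_const]) auto
    have \<eta>_Suc: "\<eta> k \<omega> < \<eta> (Suc k) \<omega>" if "\<omega> \<in> space M" for k \<omega>
      using \<theta>(2)[OF that] by (simp add: \<eta>_def)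
    define \<rho> where "\<rho> k \<omega> = \<sigma> (\<eta> k \<omega>) \<omega>" for k \<omega>
    have \<rho>: "bstime (\<rho> k)" for k
      unfolding \<rho>_def by (rule bstime_sample[OF \<eta>])
    have \<rho>_Suc: "\<rho> k \<omega> < \<rho> (Suc k) \<omega>" if "\<omega> \<in> space M" for k \<omega>
      unfolding \<rho>_def using that by (intro \<sigma>_less \<eta>_Suc)
    have NT_at_\<rho>: "NT_at c (\<rho> k) (\<rho> (Suc k)) = NT_at c' (\<eta> k) (\<eta> (Suc k))" for k
      by (simp add: fun_eq_iff NT_at_def c'_def \<rho>_def[abs_def])

    have on_A: "AE \<omega> in M. \<omega> \<in> A - Z \<longrightarrow>
        NT_at c (\<rho> k) (\<rho> (Suc k)) \<omega> = NT_at c'' (\<theta> k) (\<theta> (Suc k)) \<omega>" for k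
    proof -
      \<comment> \<open>\<open>A\<close> is known at every later sampled time, so consistency at the
        random index \<open>\<theta> k\<close> applies on it.\<close>
      have "AE \<omega> in M. \<omega> \<in> A \<longrightarrow> NT_at c' (\<theta> k) (\<eta> (Suc k)) \<omega> = NT_at c' (\<theta> k) (\<theta> (Suc k)) \<omega>"
      proof (rule s1.NT_at_cong_AE[OF \<theta>(1) sampled.sets_F_pre_sigma[OF A \<theta>(1)] \<eta> \<theta>(1)])
        show "AE \<omega> in M. \<omega> \<in> A \<longrightarrow> \<eta> (Suc k) \<omega> = \<theta> (Suc k) \<omega> \<and> \<theta> k \<omega> < \<theta> (Suc k) \<omega>"
          by (intro AE_I2) (simp add: \<eta>_def \<theta>(2))
      qed simp
      \<comment> \<open>Avoidance of \<open>r\<close> is known for fixed indices; collecting all m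
        allows evaluation at the random \<open>\<theta> k\<close>.\<close>
      moreover have "AE \<omega> in M. \<forall>m. \<omega> \<in> A - Z \<longrightarrow> \<sigma> m \<omega> < \<sigma> (\<theta> (Suc k) \<omega>) \<omega> \<longrightarrow> c' m (\<theta> (Suc k)) \<omega> \<noteq> r"
        unfolding c'_def by (subst AE_all_countable) (intro allI avoid[OF bstime_sample[OF \<theta>(1)]])
      ultimately show ?thesis
        using AE_space
      proof eventually_elim
        case (elim \<omega>)
        then show ?case
          using \<sigma>_less[OF elim(3) \<theta>(2)[OF elim(3), of k]]
          by (auto simp: NT_at_\<rho> NT_at_def c''_def \<eta>_def)
      qed
    qed
    have off_A: "AE \<omega> in M. \<omega> \<in> space M - A - Z \<longrightarrow> NT_at c (\<rho> k) (\<rho> (Suc k)) \<omega> = r" for k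
    proof -
      have "space M - A \<in> sets (G k)"
        using sampled.sets_F_le[OF sampled.sets_F_Compl[OF A]] by simp
      \<comment> \<open>Off \<open>A\<close> the next time is the constant \<open>Suc k\<close>,
        whose sample is \<open>\<sigma> (Suc k)\<close>; there \<open>red\<close> gives the
        colour.\<close>
      then have "AE \<omega> in M. \<omega> \<in> space M - A \<longrightarrow> c' k (\<eta> (Suc k)) \<omega> = c' k (\<lambda>_. Suc k) \<omega>"
        by (rule s1.colour_cong[OF _ \<eta> sampled.bstime_const]) (simp add: \<eta>_def)
      then show ?thesis
        using red[of k] by eventually_elim (auto simp: NT_at_\<rho> NT_at_def c'_def \<eta>_def)
    qed
    have "AE \<omega> in M. \<forall>k. \<omega> \<in> A - Z \<longrightarrow> NT_at c (\<rho> k) (\<rho> (Suc k)) \<omega> = NT_at c'' (\<theta> k) (\<theta> (Suc k)) \<omega>"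
      by (subst AE_all_countable) (intro allI on_A)
    moreover have "AE \<omega> in M. \<forall>k. \<omega> \<in> space M - A - Z \<longrightarrow> NT_at c (\<rho> k) (\<rho> (Suc k)) \<omega> = r"
      by (subst AE_all_countable) (intro allI off_A)
    ultimately have "AE \<omega> in M. \<omega> \<in> monochromatic M c'' \<theta> - Z \<longrightarrow> \<omega> \<in> monochromatic M c \<rho>"
    proof eventually_elim
      case (elim \<omega>)
      \<comment> \<open>On \<open>A\<close> the colours are those of \<open>c''\<close>, hence
        constant; off \<open>A\<close> they are all \<open>r\<close>, whatever \<open>c''\<close>
        does there.\<close>
      then show ?case
        by (cases "\<omega> \<in> A") (simp_all add: monochromatic_def)
    qed
    moreover have "monochromatic M c \<rho> \<in> events"
      unfolding monochromatic_def using insert.hyps(1) by (intro monochromatic_events \<rho> \<rho>_Suc) auto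
    ultimately have "prob (monochromatic M c'' \<theta> - Z) \<le> prob (monochromatic M c \<rho>)"
      by (rule finite_measure_mono_AE)
    moreover have "prob (monochromatic M c'' \<theta>) \<le> prob (monochromatic M c'' \<theta> - Z) + prob Z"
    proof -
      have ev: "monochromatic M c'' \<theta> \<in> events"
        unfolding monochromatic_def using insert.hyps(1) by (intro s2.monochromatic_events \<theta>)
      have "prob (monochromatic M c'' \<theta>) \<le> prob ((monochromatic M c'' \<theta> - Z) \<union> Z)"
        using ev Z by (intro finite_measure_mono) auto
      also have "\<dots> \<le> prob (monochromatic M c'' \<theta> - Z) + prob Z"
        using ev Z by (intro measure_Un_le) auto
      finally show ?thesis .
    qed
    ultimately have "prob (monochromatic M c \<rho>) > 1 - e"
      using \<theta>_prob Z by linarith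
    then show ?thesis
      using \<rho> \<rho>_Suc by blast
  qed
qed

theorem theorem4p3:
  fixes M :: "'a measure" and F :: "nat \<Rightarrow> 'a measure"
    and C :: "'c set" and c :: "nat \<Rightarrow> ('a \<Rightarrow> nat) \<Rightarrow> 'a \<Rightarrow> 'c" and \<epsilon> :: real
  assumes "prob_space M"
    and "filtration (space M) F" and "\<And>n. subalgebra M (F n)"
    and "finite C"
    and "NT_function M F (count_space UNIV) c" and "valued_in M F C c"
    and "consistent M F c"
    and "\<epsilon> > 0"
  shows "\<exists>\<theta> :: nat \<Rightarrow> 'a \<Rightarrow> nat.
    (\<forall>k. bounded_stopping_time M F (\<theta> k)) \<and>
    (\<forall>k. \<forall>\<omega>\<in>space M. \<theta> k \<omega> < \<theta> (Suc k) \<omega>) \<and>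
    measure M {\<omega> \<in> space M. \<forall>k.
      NT_at c (\<theta> k) (\<theta> (Suc k)) \<omega> = NT_at c (\<theta> (Suc k)) (\<theta> (Suc (Suc k))) \<omega>} > 1 - \<epsilon>"
proof -
  have "colouring M F C c"
    using assms by (simp add: colouring_def colouring_axioms_def filtered_prob_space_def filtered_prob_space_axioms_def)
  from stochastic_ramsey[OF assms(4) this assms(8)] show ?thesis
    by (simp only: monochromatic_def)
qed

end
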